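(* Let $H$, $A$, $(H^s)_{s\in\mathbb{R}}$ and the family $\{B(t)\}_{t\ge 0}$ of unbounded antisymmetric operators on $H$ be as in the context (including the standing well-posedness and energy properties listed there), and let $c_B>0$ be the constant such that $|\mathrm{Re}\langle B(t)\phi,A\phi\rangle|\le c_B\|\phi\|_{H^1}^2$ for all $\phi\in H^1$ and all $t\ge 0$. Assume that there are $p\in(0,\infty)$ and $a>0$ such that for every initial time $\tau_0\ge 0$ and every $f^{\tau_0}\in H^1$, the solution $f$ of the inviscid problem $\partial_t f+B(t)f=0$, $f(\tau_0)=f^{\tau_0}$, satisfies $$\|f(t)\|_{H^{-1}}\le \frac{a}{(t-\tau_0)^p}\,\|f^{\tau_0}\|_{H^1},\qquad \forall t>\tau_0 .$$ Then for every $\nu\in(0,1)$ and every $f^{in}\in H$, the solution $f^\nu$ of the viscous problem $\partial_t f^\nu+B(t)f^\nu+\nu Af^\nu=0$, $f^\nu(0)=f^{in}$, satisfies $$\|f^\nu(t)\|_H\le e^{-c_0\nu^q t}\,\|f^{in}\|_H,\qquad \forall t>\frac{1}{\nu^q},$$ with $$q=\frac{2}{2+p},\qquad c_0=\frac{1}{128}\min\left\{\frac{1}{2(1+c_B)},\frac{1}{a\,4^p}\right\}.$$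
   Context: $H$ is a separable (real or complex) Hilbert space with norm $\|\cdot\|_H$ and scalar (Hermitian) product $\langle\cdot,\cdot\rangle$. $A:\mathcal{D}(A)\to H$ is a strictly positive self-adjoint unbounded linear operator with $\mathcal{D}(A)$ compactly embedded in $H$; its eigenvalues are $0<\lambda_1\le\lambda_2\le\dots$, $\lambda_j\to\infty$, with orthonormal eigenbasis $\{e_j\}_{j\in\mathbb{N}}$. For $s\in\mathbb{R}$, $H^s$ is the Hilbert space with norm $\|\phi\|_{H^s}^2=\sum_{j\ge1}\lambda_j^{s}|\phi_j|^2$, $\phi_j=\langle\phi,e_j\rangle$ (so $H^0=H$, $\|\phi\|_{H^1}^2=\langle A\phi,\phi\rangle$, $\|\phi\|_{H^2}=\|A\phi\|_H$; for $s<0$ it is the corresponding completion). $\{B(t)\}_{t\ge0}$ is a family of unbounded antisymmetric operators on $H$ such that, for some $\sigma>0$ and some constant $c_B>0$, uniformly in $t\ge0$: $\|B(t)\phi\|_H\le c_B\|\phi\|_{H^\sigma}$ for all $\phi\in H^\sigma$, and $|\mathrm{Re}\langle B(t)\phi,A\phi\rangle|\le c_B\|\phi\|_{H^1}^2$ for all $\phi\in H^1$. Inviscid problem with initial time $\tau_0\ge0$: $\partial_tf+B(t)f=0$, $f(\tau_0)=f^{\tau_0}$. Viscous problem, $\nu\in(0,1)$: $\partial_tf^\nu+B(t)f^\nu+\nu Af^\nu=0$, $f^\nu(0)=f^{in}$. Standing properties of solutions: (i) for each $\tau_0\ge0$ and $f^{\tau_0}\in H^1$ the inviscid problem has a unique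 solution $f\in C([\tau_0,\infty);H^1)$, and $\|f(t)\|_H=\|f^{\tau_0}\|_H$ for all $t\ge\tau_0$; (ii) for each $f^{in}\in H$ the viscous problem has a unique solution $f^\nu\in L^2_{loc}(0,\infty;H^1)\cap C([0,\infty);H)$, satisfying $\frac{d}{dt}\|f^\nu\|_H^2+2\nu\|f^\nu\|_{H^1}^2=0$; if the datum (given at time $0$ or at any later time) is in $H^1$, then from that time on $f^\nu$ is in $L^2_{loc}(H^2)\cap C(H^1)$ and $\frac{d}{dt}\|f^\nu\|_{H^1}^2+2\nu\|f^\nu\|_{H^2}^2\le 2c_B\|f^\nu\|_{H^1}^2$; (iii) if $f$ solves the inviscid problem from time $\tau_0$ with $f^{\tau_0}\in H^1$, and $f^\nu(\tau_0)\in H^1$, then for $t>\tau_0$, $\frac{d}{dt}\|f^\nu-f\|_H^2=-2\nu\,\mathrm{Re}\langle Af^\nu,f^\nu-f\rangle$. *)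

theory Defs
  imports "HOL-Analysis.Analysis"
begin

(* The scalar field K is either \<real> or UNIV, as a set of complex numbers, so that real and complex
   Hilbert spaces are treated together.  The real Hilbert space structure of the type 'h carries
   the norm, ip is the K-valued scalar product, linear in its first argument.  In the real case
   smul c is unconstrained for non-real c. *)
locale hilbert_space_over =
  fixes K :: "complex set"
    and smul :: "complex \<Rightarrow> 'h::{real_inner, complete_space} \<Rightarrow> 'h"
    and ip :: "'h \<Rightarrow> 'h \<Rightarrow> complex"
  assumes scalars: "K = \<real> \<or> K = UNIV"
    and smul_of_real: "smul (of_real r) x = r *\<^sub>R x"
    and smul_add_left: "b \<in> K \<Longrightarrow> c \<in> K \<Longrightarrow> smul (b + c) x = smul b x + smul c x"
    and smul_add_right: "c \<in> K \<Longrightarrow> smul c (x + y) = smul c x + smul c y"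
    and smul_smul: "b \<in> K \<Longrightarrow> c \<in> K \<Longrightarrow> smul b (smul c x) = smul (b * c) x"
    and ip_in: "ip x y \<in> K"
    and ip_add: "ip (x + y) z = ip x z + ip y z"
    and ip_smul: "c \<in> K \<Longrightarrow> ip (smul c x) y = c * ip x y"
    and ip_cnj: "ip y x = cnj (ip x y)"
    and Re_ip: "Re (ip x y) = inner x y"

definition linear_operator ::
    "complex set \<Rightarrow> (complex \<Rightarrow> 'h::real_vector \<Rightarrow> 'h) \<Rightarrow> 'h set \<Rightarrow> ('h \<Rightarrow> 'h) \<Rightarrow> bool" where
  "linear_operator K smul D T \<longleftrightarrow>
     0 \<in> D \<and> (\<forall>x\<in>D. \<forall>y\<in>D. x + y \<in> D \<and> T (x + y) = T x + T y) \<and>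
     (\<forall>c\<in>K. \<forall>x\<in>D. smul c x \<in> D \<and> T (smul c x) = smul c (T x))"

definition adjoint_domain ::
    "('h \<Rightarrow> 'h \<Rightarrow> complex) \<Rightarrow> 'h set \<Rightarrow> ('h \<Rightarrow> 'h) \<Rightarrow> 'h set" where
  "adjoint_domain ip D T = {y. \<exists>z. \<forall>x\<in>D. ip (T x) y = ip x z}"

definition self_adjoint ::
    "('h::real_normed_vector \<Rightarrow> 'h \<Rightarrow> complex) \<Rightarrow> 'h set \<Rightarrow> ('h \<Rightarrow> 'h) \<Rightarrow> bool" where
  "self_adjoint ip D T \<longleftrightarrow>
     closure D = UNIV \<and> (\<forall>x\<in>D. \<forall>y\<in>D. ip (T x) y = ip x (T y)) \<and> adjoint_domain ip D T = D"

definition antisymmetric_operator ::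
    "('h \<Rightarrow> 'h \<Rightarrow> complex) \<Rightarrow> 'h set \<Rightarrow> ('h \<Rightarrow> 'h) \<Rightarrow> bool" where
  "antisymmetric_operator ip D T \<longleftrightarrow> (\<forall>x\<in>D. \<forall>y\<in>D. ip (T x) y = - ip x (T y))"

(* Eigenvalues and eigenvectors are indexed from 0, i.e. lam 0 is the first eigenvalue. *)
locale positive_operator = hilbert_space_over K smul ip
  for K :: "complex set"
    and smul :: "complex \<Rightarrow> 'h::{real_inner, complete_space} \<Rightarrow> 'h"
    and ip :: "'h \<Rightarrow> 'h \<Rightarrow> complex" +
  fixes DA :: "'h set" and A :: "'h \<Rightarrow> 'h" and lam :: "nat \<Rightarrow> real" and e :: "nat \<Rightarrow> 'h"
  assumes separable: "separable_space (euclidean :: 'h topology)"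
    and A_linear: "linear_operator K smul DA A"
    and A_self_adjoint: "self_adjoint ip DA A"
    and A_positive: "x \<in> DA \<Longrightarrow> x \<noteq> 0 \<Longrightarrow> 0 < Re (ip (A x) x)"
    and A_compact_embedding: "compact (closure {x \<in> DA. norm x + norm (A x) \<le> 1})"
    and lam_pos: "0 < lam 0"
    and lam_mono: "mono lam"
    and lam_tendsto: "filterlim lam at_top sequentially"
    and e_eigen: "e j \<in> DA" "A (e j) = lam j *\<^sub>R e j"
    and e_orthonormal: "ip (e i) (e j) = (if i = j then 1 else 0)"
    and e_basis: "(\<lambda>j. smul (ip x (e j)) (e j)) sums x"

(* For s \<ge> 0 this is H^s.  For s < 0 the sums below converge for every element of H, and Hs is all
   of H, a dense subspace of the completion H^s; negative norms are only taken of elements of H. *)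
definition Hs ::
    "('h \<Rightarrow> 'h \<Rightarrow> complex) \<Rightarrow> (nat \<Rightarrow> real) \<Rightarrow> (nat \<Rightarrow> 'h) \<Rightarrow> real \<Rightarrow> 'h set" where
  "Hs ip lam e s = {x. summable (\<lambda>j. lam j powr s * (cmod (ip x (e j)))\<^sup>2)}"

definition Hs_norm ::
    "('h \<Rightarrow> 'h \<Rightarrow> complex) \<Rightarrow> (nat \<Rightarrow> real) \<Rightarrow> (nat \<Rightarrow> 'h) \<Rightarrow> real \<Rightarrow> 'h \<Rightarrow> real" where
  "Hs_norm ip lam e s x = sqrt (\<Sum>j. lam j powr s * (cmod (ip x (e j)))\<^sup>2)"

definition continuous_Hs ::
    "('h::ab_group_add \<Rightarrow> 'h \<Rightarrow> complex) \<Rightarrow> (nat \<Rightarrow> real) \<Rightarrow> (nat \<Rightarrow> 'h) \<Rightarrow> real \<Rightarrow>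
     real set \<Rightarrow> (real \<Rightarrow> 'h) \<Rightarrow> bool" where
  "continuous_Hs ip lam e s I f \<longleftrightarrow>
     (\<forall>t\<in>I. f t \<in> Hs ip lam e s \<and>
        ((\<lambda>r. Hs_norm ip lam e s (f r - f t)) \<longlongrightarrow> 0) (at t within I))"

(* Since H^s is separable, (strong) measurability of f amounts to measurability of its
   coefficients. *)
definition L2loc_Hs ::
    "('h \<Rightarrow> 'h \<Rightarrow> complex) \<Rightarrow> (nat \<Rightarrow> real) \<Rightarrow> (nat \<Rightarrow> 'h) \<Rightarrow> real \<Rightarrow>
     real set \<Rightarrow> (real \<Rightarrow> 'h) \<Rightarrow> bool" where
  "L2loc_Hs ip lam e s I f \<longleftrightarrow>
     (\<forall>j. (\<lambda>t. ip (f t) (e j)) \<in> borel_measurable (lebesgue_on I)) \<and>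
     (AE t in lebesgue_on I. f t \<in> Hs ip lam e s) \<and>
     (\<forall>a b. {a..b} \<subseteq> I \<longrightarrow> (\<lambda>t. (Hs_norm ip lam e s (f t))\<^sup>2) absolutely_integrable_on {a..b})"

(* d/dt g = h on the interval I, in the sense that h is locally integrable, g is locally absolutely
   continuous and g' = h almost everywhere. *)
definition ddt_eq ::
    "real set \<Rightarrow> (real \<Rightarrow> 'b::{banach, second_countable_topology}) \<Rightarrow> (real \<Rightarrow> 'b) \<Rightarrow> bool" where
  "ddt_eq I g h \<longleftrightarrow>
     (\<forall>s\<in>I. \<forall>t\<in>I. s \<le> t \<longrightarrow>
        h absolutely_integrable_on {s..t} \<and> g t - g s = integral {s..t} h)"

(* d/dt g \<le> h on the interval I, in the sense of distributions (g being continuous). *)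
definition ddt_le :: "real set \<Rightarrow> (real \<Rightarrow> real) \<Rightarrow> (real \<Rightarrow> real) \<Rightarrow> bool" where
  "ddt_le I g h \<longleftrightarrow>
     (\<forall>s\<in>I. \<forall>t\<in>I. s \<le> t \<longrightarrow>
        h absolutely_integrable_on {s..t} \<and> g t - g s \<le> integral {s..t} h)"

(* The equations hold weakly.  Since B(t) is antisymmetric, the action of B(t) f on a test vector
   v in H^sigma is - ip (f t) (B t v), which makes sense for every f t in H. *)
definition inviscid_solution ::
    "('h::real_normed_vector \<Rightarrow> 'h \<Rightarrow> complex) \<Rightarrow> (nat \<Rightarrow> real) \<Rightarrow> (nat \<Rightarrow> 'h) \<Rightarrow>
     (real \<Rightarrow> 'h \<Rightarrow> 'h) \<Rightarrow> real \<Rightarrow> real \<Rightarrow> 'h \<Rightarrow> (real \<Rightarrow> 'h) \<Rightarrow> bool" where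
  "inviscid_solution ip lam e B \<sigma> \<tau> f0 f \<longleftrightarrow>
     continuous_Hs ip lam e 1 {\<tau>..} f \<and> f \<tau> = f0 \<and>
     (\<forall>v\<in>Hs ip lam e \<sigma>. ddt_eq {\<tau><..} (\<lambda>t. ip (f t) v) (\<lambda>t. ip (f t) (B t v)))"

definition viscous_solution ::
    "('h::real_normed_vector \<Rightarrow> 'h \<Rightarrow> complex) \<Rightarrow> 'h set \<Rightarrow> ('h \<Rightarrow> 'h) \<Rightarrow> (nat \<Rightarrow> real) \<Rightarrow>
     (nat \<Rightarrow> 'h) \<Rightarrow> (real \<Rightarrow> 'h \<Rightarrow> 'h) \<Rightarrow> real \<Rightarrow> real \<Rightarrow> 'h \<Rightarrow> (real \<Rightarrow> 'h) \<Rightarrow> bool" where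
  "viscous_solution ip DA A lam e B \<sigma> \<nu> f_in f \<longleftrightarrow>
     L2loc_Hs ip lam e 1 {0<..} f \<and> continuous_on {0..} f \<and> f 0 = f_in \<and>
     (\<forall>v \<in> Hs ip lam e \<sigma> \<inter> DA.
        ddt_eq {0<..} (\<lambda>t. ip (f t) v)
          (\<lambda>t. ip (f t) (B t v) - of_real \<nu> * ip (f t) (A v)))"

(* In B_energy the pairing of B t x with A x is the scalar product of H, hence the restriction of
   x in H^1 to the vectors to which both operators apply. *)
locale antisymmetric_family = positive_operator K smul ip DA A lam e
  for K :: "complex set"
    and smul :: "complex \<Rightarrow> 'h::{real_inner, complete_space} \<Rightarrow> 'h"
    and ip :: "'h \<Rightarrow> 'h \<Rightarrow> complex"
    and DA :: "'h set" and A :: "'h \<Rightarrow> 'h" and lam :: "nat \<Rightarrow> real" and e :: "nat \<Rightarrow> 'h" +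
  fixes DB :: "real \<Rightarrow> 'h set" and B :: "real \<Rightarrow> 'h \<Rightarrow> 'h" and \<sigma> :: real and c\<^sub>B :: real
  assumes sigma_pos: "0 < \<sigma>" and cB_pos: "0 < c\<^sub>B"
    and B_linear: "0 \<le> t \<Longrightarrow> linear_operator K smul (DB t) (B t)"
    and B_antisymmetric: "0 \<le> t \<Longrightarrow> antisymmetric_operator ip (DB t) (B t)"
    and B_domain: "0 \<le> t \<Longrightarrow> Hs ip lam e \<sigma> \<subseteq> DB t"
    and B_bound: "0 \<le> t \<Longrightarrow> x \<in> Hs ip lam e \<sigma> \<Longrightarrow> norm (B t x) \<le> c\<^sub>B * Hs_norm ip lam e \<sigma> x"
    and B_energy: "0 \<le> t \<Longrightarrow> x \<in> Hs ip lam e 1 \<Longrightarrow> x \<in> DA \<Longrightarrow> x \<in> DB t \<Longrightarrow>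
          \<bar>Re (ip (B t x) (A x))\<bar> \<le> c\<^sub>B * (Hs_norm ip lam e 1 x)\<^sup>2"

locale well_posed_family = antisymmetric_family K smul ip DA A lam e DB B \<sigma> c\<^sub>B
  for K :: "complex set"
    and smul :: "complex \<Rightarrow> 'h::{real_inner, complete_space} \<Rightarrow> 'h"
    and ip :: "'h \<Rightarrow> 'h \<Rightarrow> complex"
    and DA :: "'h set" and A :: "'h \<Rightarrow> 'h" and lam :: "nat \<Rightarrow> real" and e :: "nat \<Rightarrow> 'h"
    and DB :: "real \<Rightarrow> 'h set" and B :: "real \<Rightarrow> 'h \<Rightarrow> 'h" and \<sigma> :: real and c\<^sub>B :: real +
  assumes inviscid_exists:
      "0 \<le> \<tau> \<Longrightarrow> f0 \<in> Hs ip lam e 1 \<Longrightarrow> \<exists>f. inviscid_solution ip lam e B \<sigma> \<tau> f0 f"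
    and inviscid_unique:
      "0 \<le> \<tau> \<Longrightarrow> inviscid_solution ip lam e B \<sigma> \<tau> f0 f \<Longrightarrow>
       inviscid_solution ip lam e B \<sigma> \<tau> f0 g \<Longrightarrow> \<tau> \<le> t \<Longrightarrow> f t = g t"
    and inviscid_norm:
      "0 \<le> \<tau> \<Longrightarrow> inviscid_solution ip lam e B \<sigma> \<tau> f0 f \<Longrightarrow> \<tau> \<le> t \<Longrightarrow> norm (f t) = norm f0"
    and viscous_exists:
      "0 < \<nu> \<Longrightarrow> \<nu> < 1 \<Longrightarrow> \<exists>f. viscous_solution ip DA A lam e B \<sigma> \<nu> f_in f"
    and viscous_unique:
      "0 < \<nu> \<Longrightarrow> \<nu> < 1 \<Longrightarrow> viscous_solution ip DA A lam e B \<sigma> \<nu> f_in f \<Longrightarrow>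
       viscous_solution ip DA A lam e B \<sigma> \<nu> f_in g \<Longrightarrow> 0 \<le> t \<Longrightarrow> f t = g t"
    and viscous_energy:
      "0 < \<nu> \<Longrightarrow> \<nu> < 1 \<Longrightarrow> viscous_solution ip DA A lam e B \<sigma> \<nu> f_in f \<Longrightarrow>
       ddt_eq {0<..} (\<lambda>t. (norm (f t))\<^sup>2) (\<lambda>t. - 2 * \<nu> * (Hs_norm ip lam e 1 (f t))\<^sup>2)"
    and viscous_regularity:
      "0 < \<nu> \<Longrightarrow> \<nu> < 1 \<Longrightarrow> viscous_solution ip DA A lam e B \<sigma> \<nu> f_in f \<Longrightarrow>
       0 \<le> \<tau> \<Longrightarrow> f \<tau> \<in> Hs ip lam e 1 \<Longrightarrow>
       L2loc_Hs ip lam e 2 {\<tau><..} f \<and> continuous_Hs ip lam e 1 {\<tau>..} f"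
    and viscous_energy_H1:
      "0 < \<nu> \<Longrightarrow> \<nu> < 1 \<Longrightarrow> viscous_solution ip DA A lam e B \<sigma> \<nu> f_in f \<Longrightarrow>
       0 \<le> \<tau> \<Longrightarrow> f \<tau> \<in> Hs ip lam e 1 \<Longrightarrow>
       ddt_le {\<tau><..} (\<lambda>t. (Hs_norm ip lam e 1 (f t))\<^sup>2)
         (\<lambda>t. 2 * c\<^sub>B * (Hs_norm ip lam e 1 (f t))\<^sup>2 - 2 * \<nu> * (Hs_norm ip lam e 2 (f t))\<^sup>2)"
    and difference_energy:
      "0 < \<nu> \<Longrightarrow> \<nu> < 1 \<Longrightarrow> viscous_solution ip DA A lam e B \<sigma> \<nu> f_in g \<Longrightarrow>
       0 \<le> \<tau> \<Longrightarrow> g \<tau> \<in> Hs ip lam e 1 \<Longrightarrow> f0 \<in> Hs ip lam e 1 \<Longrightarrow>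
       inviscid_solution ip lam e B \<sigma> \<tau> f0 f \<Longrightarrow>
       ddt_eq {\<tau><..} (\<lambda>t. (norm (g t - f t))\<^sup>2)
         (\<lambda>t. - 2 * \<nu> * Re (ip (A (g t)) (g t - f t)))"

end

(* On a time window of length T = nu^(-q) suppose that the viscous solution dissipates less than a
   small fraction of its energy.  Cut the window into about sqrt T pieces of length L ~ sqrt T and
   pick the one of least dissipation; it contains two times s1 < s2, at distance at least L/2, at
   which the H^1 norm is of order (nu T)^(-1/2).  The inviscid solution issued from f^nu(s1) stays
   close to f^nu up to s2, since the H^1 energy inequality controls the H^2 norm on the piece, while
   mixing makes it small in H^{-1} at time s2.  Pairing it with f^nu(s2), bounded in H^1, shows that
   f^nu(s2) has lost a definite fraction of its energy, a contradiction.  The exponent q is the one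
   for which nu T^(1 + p/2) = 1.  Iterating the decay over windows that end exactly at t absorbs
   the prefactor as soon as t > T. *)

theory Submission
  imports Defs
begin

section \<open>Algebra of the scalar product over the real or complex field\<close>

context hilbert_space_over
begin

lemma of_real_in_K: "of_real r \<in> K"
  using scalars by auto

lemma ip_diff: "ip (x - y) z = ip x z - ip y z"
  using ip_add[of "x - y" y z] by simp

lemma ip_scaleR: "ip (r *\<^sub>R x) y = of_real r * ip x y"
  using ip_smul[OF of_real_in_K, of r x y] by (simp add: smul_of_real)

lemma ip_scaleR_right: "ip x (r *\<^sub>R y) = of_real r * ip x y"
proof -
  have "ip x (r *\<^sub>R y) = cnj (ip (r *\<^sub>R y) x)" by (rule ip_cnj)
  also have "\<dots> = of_real r * cnj (ip y x)" by (simp add: ip_scaleR)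
  finally show ?thesis by (simp add: ip_cnj[of x y])
qed

lemma ip_smul_right: "c \<in> K \<Longrightarrow> ip x (smul c y) = cnj c * ip x y"
  using ip_cnj[of x "smul c y"] ip_cnj[of x y] by (simp add: ip_smul)

lemma ip_self: "ip x x = of_real ((norm x)\<^sup>2)"
proof (rule complex_eqI)
  show "Re (ip x x) = Re (of_real ((norm x)\<^sup>2))"
    by (simp add: Re_ip power2_norm_eq_inner)
  show "Im (ip x x) = Im (of_real ((norm x)\<^sup>2))"
    using arg_cong[OF ip_cnj[of x x], of Im] by simp
qed

lemma norm_smul: "c \<in> K \<Longrightarrow> norm (smul c x) = cmod c * norm x"
proof -
  assume c: "c \<in> K"
  have "of_real ((norm (smul c x))\<^sup>2) = ip (smul c x) (smul c x)" by (simp add: ip_self)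
  also have "\<dots> = (c * cnj c) * ip x x" using c by (simp add: ip_smul ip_smul_right)
  also have "\<dots> = of_real ((cmod c * norm x)\<^sup>2)"
    by (simp only: complex_norm_square[symmetric] ip_self power_mult_distrib of_real_mult)
  finally have "(norm (smul c x))\<^sup>2 = (cmod c * norm x)\<^sup>2" by (simp only: of_real_eq_iff)
  then show ?thesis by (simp add: power2_eq_iff_nonneg)
qed

end

section \<open>Eigenfunction expansions and the norms of H^s\<close>

context positive_operator
begin

lemma lam_gt_0: "0 < lam j"
  using lam_pos lam_mono by (meson le0 less_le_trans monoD)

text \<open>Parseval's identity: the expansion of \<open>x\<close> in the eigenbasis is paired with
  \<open>y\<close> term by term, the pairing being continuous.\<close>

lemma inner_sums: "(\<lambda>j. Re (ip x (e j) * cnj (ip y (e j)))) sums inner x y"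
proof -
  have "(\<lambda>j. inner (smul (ip x (e j)) (e j)) y) sums inner x y"
    using bounded_linear.sums[OF bounded_linear_inner_left e_basis] .
  moreover have "inner (smul (ip x (e j)) (e j)) y = Re (ip x (e j) * cnj (ip y (e j)))" for j
    by (metis Re_ip ip_cnj ip_in ip_smul)
  ultimately show ?thesis by simp
qed

lemma norm_sums: "(\<lambda>j. (cmod (ip x (e j)))\<^sup>2) sums (norm x)\<^sup>2"
proof -
  have "Re (z * cnj z) = (cmod z)\<^sup>2" for z
    by (metis Re_complex_of_real complex_norm_square)
  then show ?thesis
    using inner_sums[of x x] by (simp add: power2_norm_eq_inner)
qed

lemma Hs_norm_sums:
  assumes "x \<in> Hs ip lam e s"
  shows "(\<lambda>j. lam j powr s * (cmod (ip x (e j)))\<^sup>2) sums (Hs_norm ip lam e s x)\<^sup>2"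
proof -
  have "summable (\<lambda>j. lam j powr s * (cmod (ip x (e j)))\<^sup>2)"
    using assms by (simp add: Hs_def)
  moreover from this have "0 \<le> (\<Sum>j. lam j powr s * (cmod (ip x (e j)))\<^sup>2)"
    by (intro suminf_nonneg) auto
  ultimately show ?thesis
    by (simp add: Hs_norm_def summable_sums)
qed

lemma Hs_diff:
  assumes "x \<in> Hs ip lam e s" "y \<in> Hs ip lam e s"
  shows "x - y \<in> Hs ip lam e s"
proof -
  have "summable (\<lambda>j. 2 * (lam j powr s * (cmod (ip x (e j)))\<^sup>2) + 2 * (lam j powr s * (cmod (ip y (e j)))\<^sup>2))"
    using assms unfolding Hs_def by (intro summable_add summable_mult) auto
  moreover have "norm (lam j powr s * (cmod (ip (x - y) (e j)))\<^sup>2) \<le>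
      2 * (lam j powr s * (cmod (ip x (e j)))\<^sup>2) + 2 * (lam j powr s * (cmod (ip y (e j)))\<^sup>2)" for j
  proof -
    let ?a = "ip x (e j)" and ?b = "ip y (e j)"
    have "(cmod (?a - ?b))\<^sup>2 \<le> (cmod ?a + cmod ?b)\<^sup>2"
      by (intro power_mono norm_triangle_ineq4) auto
    also have "\<dots> \<le> 2 * (cmod ?a)\<^sup>2 + 2 * (cmod ?b)\<^sup>2"
      using zero_le_power2[of "cmod ?a - cmod ?b"] by (simp add: power2_eq_square algebra_simps)
    finally have "lam j powr s * (cmod (?a - ?b))\<^sup>2 \<le> lam j powr s * (2 * (cmod ?a)\<^sup>2 + 2 * (cmod ?b)\<^sup>2)"
      by (intro mult_left_mono) auto
    then show ?thesis by (simp add: ip_diff algebra_simps)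
  qed
  ultimately show ?thesis
    unfolding Hs_def mem_Collect_eq by (rule summable_comparison_test')
qed

text \<open>Poincare's inequality, from comparing every eigenvalue with the lowest one.\<close>

lemma norm_le_H1_norm:
  assumes "x \<in> Hs ip lam e 1"
  shows "sqrt (lam 0) * norm x \<le> Hs_norm ip lam e 1 x"
proof -
  have "lam 0 * (cmod (ip x (e j)))\<^sup>2 \<le> lam j powr 1 * (cmod (ip x (e j)))\<^sup>2" for j
    using lam_mono lam_gt_0[of j] by (intro mult_right_mono) (auto simp: mono_def less_imp_le)
  then have "lam 0 * (norm x)\<^sup>2 \<le> (Hs_norm ip lam e 1 x)\<^sup>2"
    by (intro sums_le[OF _ sums_mult[OF norm_sums] Hs_norm_sums[OF assms]])
  then have "(sqrt (lam 0) * norm x)\<^sup>2 \<le> (Hs_norm ip lam e 1 x)\<^sup>2"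
    using lam_pos by (simp add: power_mult_distrib)
  moreover have "0 \<le> Hs_norm ip lam e 1 x"
    using Hs_norm_sums[OF assms] unfolding Hs_norm_def
    by (auto intro!: real_sqrt_ge_zero suminf_nonneg simp: sums_iff)
  ultimately show ?thesis by (rule power2_le_imp_le)
qed

text \<open>The weights are at most \<open>1 / lam 0\<close>, so summability follows from Parseval.
  Thus the series behind the H^{-1} norm is a genuine sum for every vector.\<close>

lemma H_minus1_UNIV: "y \<in> Hs ip lam e (-1)"
proof -
  have "summable (\<lambda>j. (1 / lam 0) * (cmod (ip y (e j)))\<^sup>2)"
    using norm_sums[of y] by (intro summable_mult) (auto simp: sums_iff)
  moreover have "norm (lam j powr -1 * (cmod (ip y (e j)))\<^sup>2) \<le> (1 / lam 0) * (cmod (ip y (e j)))\<^sup>2" for j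
  proof -
    have "lam j powr -1 \<le> 1 / lam 0"
      using lam_mono lam_gt_0[of j] lam_pos
      by (simp add: powr_minus_divide mono_def frac_le)
    then have "lam j powr -1 * (cmod (ip y (e j)))\<^sup>2 \<le> (1 / lam 0) * (cmod (ip y (e j)))\<^sup>2"
      by (rule mult_right_mono) simp
    then show ?thesis by (simp only: real_norm_def abs_of_nonneg mult_nonneg_nonneg powr_ge_zero zero_le_power2)
  qed
  ultimately show ?thesis
    unfolding Hs_def mem_Collect_eq by (rule summable_comparison_test')
qed

text \<open>The duality of H^1 and H^{-1}, combined with Young's inequality with a free weight
  \<open>k\<close>. In this form it holds coefficient by coefficient and only has to be
  summed.\<close>

lemma inner_le_dual_norms:
  assumes x: "x \<in> Hs ip lam e 1" and k: "0 < k"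
  shows "inner x y \<le> k / 2 * (Hs_norm ip lam e 1 x)\<^sup>2 + 1 / (2 * k) * (Hs_norm ip lam e (-1) y)\<^sup>2"
proof (rule sums_le[OF _ inner_sums sums_add[OF sums_mult[OF Hs_norm_sums[OF x]]
      sums_mult[OF Hs_norm_sums[OF H_minus1_UNIV]]]])
  fix j
  let ?a = "cmod (ip x (e j))" and ?b = "cmod (ip y (e j))" and ?l = "lam j"
  have l: "0 < ?l" by (rule lam_gt_0)
  have "Re (ip x (e j) * cnj (ip y (e j))) \<le> ?a * ?b"
    using complex_Re_le_cmod[of "ip x (e j) * cnj (ip y (e j))"] by (simp add: norm_mult)
  also have "?a * ?b \<le> k / 2 * (?l * ?a\<^sup>2) + 1 / (2 * k) * (?b\<^sup>2 / ?l)"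
  proof -
    have "0 \<le> (k * ?l * ?a - ?b)\<^sup>2 / (2 * k * ?l)" using k l by simp
    also have "\<dots> = k / 2 * (?l * ?a\<^sup>2) + 1 / (2 * k) * (?b\<^sup>2 / ?l) - ?a * ?b"
      using k l by (simp add: field_simps power2_eq_square)
    finally show ?thesis by simp
  qed
  finally show "Re (ip x (e j) * cnj (ip y (e j))) \<le>
      k / 2 * (?l powr 1 * ?a\<^sup>2) + 1 / (2 * k) * (?l powr - 1 * ?b\<^sup>2)"
    using l by (simp add: powr_minus_divide)
qed

text \<open>The Riesz-Fischer argument: by Pythagoras the squared norm of a block of the series is
  the corresponding block of the scalar series, so the partial sums are Cauchy in a complete
  space.\<close>

lemma orthonormal_series_summable:
  assumes K: "\<And>j. c j \<in> K" and c: "summable (\<lambda>j. (cmod (c j))\<^sup>2)"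
  shows "summable (\<lambda>j. smul (c j) (e j))"
proof -
  have nrm: "(norm (\<Sum>j\<in>F. smul (c j) (e j)))\<^sup>2 = (\<Sum>j\<in>F. (cmod (c j))\<^sup>2)" if "finite F" for F
  proof -
    have orth: "pairwise (\<lambda>i j. orthogonal (smul (c i) (e i)) (smul (c j) (e j))) F"
      using K by (auto simp: pairwise_def orthogonal_def ip_smul ip_smul_right e_orthonormal
          simp flip: Re_ip)
    have "norm (e j) = 1" for j
      using ip_self[of "e j"] norm_ge_zero[of "e j"]
      by (auto simp: e_orthonormal power2_eq_1_iff simp flip: of_real_power)
    then show ?thesis
      using norm_sum_Pythagorean[OF that orth] K by (simp add: norm_smul)
  qed
  have "Cauchy (\<lambda>n. \<Sum>j<n. smul (c j) (e j))"
  proof (rule CauchyI')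
    fix \<epsilon> :: real assume "0 < \<epsilon>"
    then have "0 < \<epsilon>\<^sup>2" by simp
    then obtain N where N: "\<And>m n. N \<le> m \<Longrightarrow> norm (\<Sum>j=m..<n. (cmod (c j))\<^sup>2) < \<epsilon>\<^sup>2"
      using c unfolding summable_Cauchy by blast
    have "norm ((\<Sum>j<m. smul (c j) (e j)) - (\<Sum>j<n. smul (c j) (e j))) < \<epsilon>"
      if "N \<le> m" "m < n" for m n
    proof (rule power2_less_imp_less)
      have "(\<Sum>j<n. smul (c j) (e j)) - (\<Sum>j<m. smul (c j) (e j)) = (\<Sum>j=m..<n. smul (c j) (e j))"
        using that by (simp add: sum_diff_nat_ivl lessThan_atLeast0)
      then have "(norm ((\<Sum>j<n. smul (c j) (e j)) - (\<Sum>j<m. smul (c j) (e j))))\<^sup>2 < \<epsilon>\<^sup>2"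
        using N[OF that(1), of n] by (simp add: nrm abs_less_iff)
      then show "(norm ((\<Sum>j<m. smul (c j) (e j)) - (\<Sum>j<n. smul (c j) (e j))))\<^sup>2 < \<epsilon>\<^sup>2"
        by (subst norm_minus_commute)
    qed (use \<open>0 < \<epsilon>\<close> in simp)
    then show "\<exists>M. \<forall>m\<ge>M. \<forall>n>m. dist (\<Sum>j<m. smul (c j) (e j)) (\<Sum>j<n. smul (c j) (e j)) < \<epsilon>"
      unfolding dist_norm by blast
  qed
  then show ?thesis
    by (simp add: summable_iff_convergent Cauchy_convergent_iff)
qed

section \<open>The operator \<open>A\<close> and its domain\<close>

lemma A_symmetric: "x \<in> DA \<Longrightarrow> y \<in> DA \<Longrightarrow> ip (A x) y = ip x (A y)"
  using A_self_adjoint by (simp add: self_adjoint_def)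

lemma ip_A_e: "x \<in> DA \<Longrightarrow> ip (A x) (e j) = of_real (lam j) * ip x (e j)"
  by (simp add: A_symmetric e_eigen ip_scaleR_right)

text \<open>Over the reals there is no imaginary part to compare; over the complex numbers the
  hypothesis applied to \<open>smul \<i> x\<close> compares the imaginary parts. So adjointness can
  be checked with the real inner product, to which Parseval's identity applies.\<close>

lemma ip_eq_if_inner_eq:
  assumes D: "\<And>c x. c \<in> K \<Longrightarrow> x \<in> D \<Longrightarrow> smul c x \<in> D \<and> T (smul c x) = smul c (T x)"
    and eq: "\<And>x. x \<in> D \<Longrightarrow> inner (T x) y = inner x z" and x: "x \<in> D"
  shows "ip (T x) y = ip x z"
proof (rule complex_eqI)
  show "Re (ip (T x) y) = Re (ip x z)" using eq[OF x] by (simp add: Re_ip)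
  show "Im (ip (T x) y) = Im (ip x z)"
    using scalars
  proof
    assume "K = \<real>"
    then show ?thesis
      using ip_in[of "T x" y] ip_in[of x z] by (simp add: complex_is_Real_iff)
  next
    assume "K = UNIV"
    then have i: "\<i> \<in> K" by simp
    have "Re (\<i> * ip (T x) y) = Re (\<i> * ip x z)"
      using eq[of "smul \<i> x"] D[OF i x] i by (simp add: ip_smul flip: Re_ip)
    then show ?thesis by simp
  qed
qed

text \<open>By Riesz-Fischer the formal expansion of \<open>A x\<close> converges to some
  \<open>z\<close>. Parseval gives \<open>ip (A y) x = ip y z\<close> for all \<open>y\<close> in
  \<open>DA\<close>, so \<open>x\<close> lies in the domain of the adjoint, which is
  \<open>DA\<close> by self-adjointness.\<close>

lemma H2_subset_DA:
  assumes x: "x \<in> Hs ip lam e 2"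
  shows "x \<in> DA"
proof -
  define c where "c j = of_real (lam j) * ip x (e j)" for j
  have cK: "c j \<in> K" for j
    using scalars ip_in[of x "e j"] by (auto simp: c_def)
  have "(cmod (c j))\<^sup>2 = lam j powr 2 * (cmod (ip x (e j)))\<^sup>2" for j
    using lam_gt_0[of j] by (simp add: c_def norm_mult power_mult_distrib)
  then have "summable (\<lambda>j. (cmod (c j))\<^sup>2)"
    using x by (simp add: Hs_def)
  then obtain z where z: "(\<lambda>j. smul (c j) (e j)) sums z"
    using orthonormal_series_summable cK summable_sums by blast
  have "ip (A y) x = ip y z" if "y \<in> DA" for y
  proof (rule ip_eq_if_inner_eq[OF _ _ that])
    fix c' y' assume "c' \<in> K" "y' \<in> DA"
    then show "smul c' y' \<in> DA \<and> A (smul c' y') = smul c' (A y')"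
      using A_linear by (simp add: linear_operator_def)
  next
    fix y' assume y': "y' \<in> DA"
    have "(\<lambda>j. inner y' (smul (c j) (e j))) sums inner y' z"
      using bounded_linear.sums[OF bounded_linear_inner_right z] .
    moreover have "inner y' (smul (c j) (e j)) = Re (ip (A y') (e j) * cnj (ip x (e j)))" for j
      using cK[of j] by (simp add: ip_smul_right ip_A_e[OF y'] c_def algebra_simps flip: Re_ip)
    ultimately show "inner (A y') x = inner y' z"
      using inner_sums[of "A y'" x] by (simp add: sums_iff)
  qed
  then have "x \<in> adjoint_domain ip DA A"
    by (auto simp: adjoint_domain_def)
  then show ?thesis
    using A_self_adjoint by (simp add: self_adjoint_def)
qed

lemma norm_A:
  assumes x: "x \<in> Hs ip lam e 2"
  shows "(norm (A x))\<^sup>2 = (Hs_norm ip lam e 2 x)\<^sup>2"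
proof -
  have "(cmod (ip (A x) (e j)))\<^sup>2 = lam j powr 2 * (cmod (ip x (e j)))\<^sup>2" for j
    using lam_gt_0[of j] ip_A_e[OF H2_subset_DA[OF x]] by (simp add: norm_mult power_mult_distrib)
  then show ?thesis
    using norm_sums[of "A x"] Hs_norm_sums[OF x] by (simp add: sums_iff)
qed

lemma A_nonneg: "x \<in> DA \<Longrightarrow> 0 \<le> Re (ip (A x) x)"
  using A_positive[of x] by (cases "x = 0") (auto simp: Re_ip)

text \<open>The part \<open>ip (A x) x\<close> has the favourable sign and is dropped; the cross
  term is bounded by Cauchy-Schwarz and Young. Up to the factor \<open>\<nu>\<close>, the left side
  is the rate at which a viscous solution \<open>x\<close> separates from an inviscid one
  \<open>y\<close>.\<close>

lemma Re_ip_A_diff_ge: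
  assumes x: "x \<in> Hs ip lam e 2" and k: "0 < k"
  shows "- 2 * Re (ip (A x) (x - y)) \<le> norm y * (k * (Hs_norm ip lam e 2 x)\<^sup>2 + 1 / k)"
proof -
  have "Re (ip (A x) (x - y)) = Re (ip (A x) x) - inner (A x) y"
    by (simp add: Re_ip inner_diff_right)
  then have "- 2 * Re (ip (A x) (x - y)) \<le> 2 * (norm (A x) * norm y)"
    using A_nonneg[OF H2_subset_DA[OF x]] norm_cauchy_schwarz[of "A x" y] by simp
  also have "2 * norm (A x) \<le> k * (norm (A x))\<^sup>2 + 1 / k"
  proof -
    have "0 \<le> (k * norm (A x) - 1)\<^sup>2 / k" using k by simp
    also have "\<dots> = k * (norm (A x))\<^sup>2 + 1 / k - 2 * norm (A x)"
      using k by (simp add: field_simps power2_eq_square)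
    finally show ?thesis by simp
  qed
  then have "norm y * (2 * norm (A x)) \<le> norm y * (k * (norm (A x))\<^sup>2 + 1 / k)"
    by (rule mult_left_mono) simp
  then have "2 * (norm (A x) * norm y) \<le> norm y * (k * (norm (A x))\<^sup>2 + 1 / k)"
    by (simp only: mult.commute mult.left_commute)
  finally show ?thesis by (simp add: norm_A[OF x])
qed

lemma continuous_H1_imp_continuous:
  assumes "continuous_Hs ip lam e 1 I f"
  shows "continuous_on I f"
  unfolding continuous_on_def
proof
  fix t assume t: "t \<in> I"
  have lim: "((\<lambda>r. Hs_norm ip lam e 1 (f r - f t) / sqrt (lam 0)) \<longlongrightarrow> 0) (at t within I)"
    using assms t by (intro tendsto_divide_zero) (simp add: continuous_Hs_def)
  have "\<forall>\<^sub>F r in at t within I. norm (f r - f t) \<le> Hs_norm ip lam e 1 (f r - f t) / sqrt (lam 0)"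
    unfolding eventually_at_filter
  proof (intro always_eventually allI impI)
    fix r assume "r \<in> I"
    then show "norm (f r - f t) \<le> Hs_norm ip lam e 1 (f r - f t) / sqrt (lam 0)"
      using assms t norm_le_H1_norm[OF Hs_diff, of "f r" "f t"] lam_pos
      by (simp add: continuous_Hs_def field_simps)
  qed
  then have "((\<lambda>r. f r - f t) \<longlongrightarrow> 0) (at t within I)"
    by (rule Lim_null_comparison[OF _ lim])
  then show "(f \<longlongrightarrow> f t) (at t within I)" by (simp add: LIM_zero_iff)
qed

end

section \<open>Null sets and mean values of integrals\<close>

lemma AE_lebesgue_on_imp_negligible:
  assumes "AE x in lebesgue_on I. P x" "I \<in> sets lebesgue"
  shows "negligible {x \<in> I. \<not> P x}"
proof -
  have "AE x in lebesgue. x \<in> I \<longrightarrow> P x"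
    using assms by (simp add: AE_restrict_space_iff)
  then obtain N where "N \<in> null_sets lebesgue" "{x. \<not> (x \<in> I \<longrightarrow> P x)} \<subseteq> N"
    by (auto simp: eventually_ae_filter)
  then show ?thesis
    using negligible_subset[of N "{x \<in> I. \<not> P x}"] by (auto simp: negligible_iff_null_sets)
qed

text \<open>Otherwise \<open>h\<close> would be at least \<open>c\<close> throughout, and so would
  its mean. This selects the times of small H^1 norm.\<close>

lemma exists_less_if_integral_less:
  fixes h :: "real \<Rightarrow> real"
  assumes "h integrable_on {u..v}" "u \<le> v" "integral {u..v} h < c * (v - u)"
  shows "\<exists>s\<in>{u..v}. h s < c"
proof (rule ccontr)
  assume "\<not> ?thesis"
  then have "integral {u..v} (\<lambda>_. c) \<le> integral {u..v} h"
    using assms(1) by (intro integral_le) (auto simp: not_less)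
  then show False using assms by (simp add: mult.commute)
qed

section \<open>Smoothing and energy of the viscous flow, and its distance to the inviscid
  flow\<close>

context well_posed_family
begin

context
  fixes \<nu> :: real and f_in :: 'h and f :: "real \<Rightarrow> 'h"
  assumes nu: "0 < \<nu>" "\<nu> < 1" and sol: "viscous_solution ip DA A lam e B \<sigma> \<nu> f_in f"
begin

text \<open>Parabolic smoothing: the solution is in H^1 at almost every time, hence at some time
  before \<open>t\<close>, and from then on it stays there.\<close>

lemma viscous_in_H1:
  assumes "0 < t"
  shows "f t \<in> Hs ip lam e 1"
proof -
  have "AE r in lebesgue_on {0<..}. f r \<in> Hs ip lam e 1"
    using sol by (simp add: viscous_solution_def L2loc_Hs_def)
  then have negl: "negligible {r \<in> {0<..}. f r \<notin> Hs ip lam e 1}"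
    by (rule AE_lebesgue_on_imp_negligible) simp
  have "\<not> negligible {0<..<t}"
    using assms open_not_negligible[of "{0<..<t}"] by auto
  then have "\<not> {0<..<t} \<subseteq> {r \<in> {0<..}. f r \<notin> Hs ip lam e 1}"
    using negligible_subset[OF negl] by blast
  then obtain \<tau> where \<tau>: "0 < \<tau>" "\<tau> < t" "f \<tau> \<in> Hs ip lam e 1"
    by auto
  then have "continuous_Hs ip lam e 1 {\<tau>..} f"
    using viscous_regularity[OF nu sol, of \<tau>] by simp
  then show ?thesis
    using \<tau> by (auto simp: continuous_Hs_def)
qed

lemma viscous_H1_integrable:
  assumes "0 < s"
  shows "(\<lambda>r. (Hs_norm ip lam e 1 (f r))\<^sup>2) absolutely_integrable_on {s..t}"
proof -
  have "{s..t} \<subseteq> {0<..}" using assms by auto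
  then show ?thesis using sol by (simp add: viscous_solution_def L2loc_Hs_def)
qed

lemma viscous_energy_eq:
  assumes "0 < s" "s \<le> t"
  shows "(norm (f t))\<^sup>2 = (norm (f s))\<^sup>2 - 2 * \<nu> * integral {s..t} (\<lambda>r. (Hs_norm ip lam e 1 (f r))\<^sup>2)"
proof -
  have "(norm (f t))\<^sup>2 - (norm (f s))\<^sup>2 = integral {s..t} (\<lambda>r. - 2 * \<nu> * (Hs_norm ip lam e 1 (f r))\<^sup>2)"
    using viscous_energy[OF nu sol] assms unfolding ddt_eq_def by auto
  then show ?thesis by simp
qed

lemma viscous_norm_decreasing_pos:
  assumes "0 < s" "s \<le> t"
  shows "(norm (f t))\<^sup>2 \<le> (norm (f s))\<^sup>2"
proof -
  have "0 \<le> integral {s..t} (\<lambda>r. (Hs_norm ip lam e 1 (f r))\<^sup>2)"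
    using viscous_H1_integrable[OF assms(1)]
    by (intro integral_nonneg) (auto simp: absolutely_integrable_on_def)
  then show ?thesis using viscous_energy_eq[OF assms] nu by simp
qed

lemma viscous_continuous: "continuous_on {0..} f" and viscous_initial: "f 0 = f_in"
  using sol by (simp_all add: viscous_solution_def)

text \<open>The energy identity is available at positive times; continuity in H extends the
  comparison to \<open>s = 0\<close>.\<close>

lemma viscous_norm_decreasing:
  assumes "0 \<le> s" "s \<le> t"
  shows "norm (f t) \<le> norm (f s)"
proof (cases "s = t")
  case False
  then have st: "s < t" using assms by simp
  show ?thesis
  proof (rule continuous_ge_on_closure[where S = "{s<..<t}" and f = "\<lambda>r. norm (f r)"])
    show "continuous_on (closure {s<..<t}) (\<lambda>r. norm (f r))"
      using st assms by (intro continuous_intros continuous_on_subset[OF viscous_continuous]) auto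
    show "s \<in> closure {s<..<t}" using st by simp
    show "norm (f t) \<le> norm (f r)" if "r \<in> {s<..<t}" for r
      using viscous_norm_decreasing_pos[of r t] that assms by (auto simp: power2_le_iff_abs_le)
  qed
qed simp

text \<open>The H^1 energy inequality is integrated over the interval and the H^1 norm at the final
  time is discarded.\<close>

lemma viscous_H2:
  assumes "0 < s" "s \<le> t"
  shows "(\<lambda>r. (Hs_norm ip lam e 2 (f r))\<^sup>2) integrable_on {s..t}" (is ?int)
    and "negligible {r \<in> {s..t}. f r \<notin> Hs ip lam e 2}" (is ?negl)
    and "2 * \<nu> * integral {s..t} (\<lambda>r. (Hs_norm ip lam e 2 (f r))\<^sup>2) \<le>
      (Hs_norm ip lam e 1 (f s))\<^sup>2 + 2 * c\<^sub>B * integral {s..t} (\<lambda>r. (Hs_norm ip lam e 1 (f r))\<^sup>2)"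
proof -
  let ?g = "\<lambda>r. (Hs_norm ip lam e 1 (f r))\<^sup>2" and ?h = "\<lambda>r. (Hs_norm ip lam e 2 (f r))\<^sup>2"
  \<comment> \<open>The regularity and energy statements concern the open half-line after the
    starting time; starting at half of \<open>s\<close> puts \<open>s\<close> inside it.\<close>
  define \<tau> where "\<tau> = s / 2"
  have \<tau>: "0 < \<tau>" "\<tau> < s" using assms by (auto simp: \<tau>_def)
  have sub: "{s..t} \<subseteq> {\<tau><..}" using \<tau> by auto
  have L2: "L2loc_Hs ip lam e 2 {\<tau><..} f"
    using viscous_regularity[OF nu sol, of \<tau>] viscous_in_H1 \<tau> by simp
  then show int: ?int
    using sub by (simp add: L2loc_Hs_def absolutely_integrable_on_def)
  have "negligible {r \<in> {\<tau><..}. f r \<notin> Hs ip lam e 2}"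
    using L2 by (intro AE_lebesgue_on_imp_negligible) (simp_all add: L2loc_Hs_def)
  then show ?negl
    by (rule negligible_subset) (use sub in auto)
  have "ddt_le {\<tau><..} ?g (\<lambda>r. 2 * c\<^sub>B * ?g r - 2 * \<nu> * ?h r)"
    using viscous_energy_H1[OF nu sol, of \<tau>] viscous_in_H1 \<tau> by simp
  then have "?g t - ?g s \<le> integral {s..t} (\<lambda>r. 2 * c\<^sub>B * ?g r - 2 * \<nu> * ?h r)"
    using \<tau> assms unfolding ddt_le_def by auto
  also have "\<dots> = 2 * c\<^sub>B * integral {s..t} ?g - 2 * \<nu> * integral {s..t} ?h"
    using int viscous_H1_integrable[OF assms(1), of t]
    by (subst integral_diff) (auto simp: absolutely_integrable_on_def intro!: integrable_on_mult_right)
  finally have "2 * \<nu> * integral {s..t} ?h \<le> ?g s + 2 * c\<^sub>B * integral {s..t} ?g - ?g t" by simp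
  also have "\<dots> \<le> ?g s + 2 * c\<^sub>B * integral {s..t} ?g" by simp
  finally show "2 * \<nu> * integral {s..t} ?h \<le> ?g s + 2 * c\<^sub>B * integral {s..t} ?g" .
qed

text \<open>The inviscid flow conserves the norm, so the speed of separation is governed by the H^2
  norm of the viscous solution. The Young weight \<open>k\<close> stays free, to be balanced against
  the length of the interval later.\<close>

lemma viscous_inviscid_distance:
  assumes \<tau>: "0 < \<tau>" "\<tau> \<le> t" and k: "0 < k"
    and fi: "inviscid_solution ip lam e B \<sigma> \<tau> (f \<tau>) fi"
  shows "(norm (f t - fi t))\<^sup>2 \<le>
    \<nu> * norm (f \<tau>) * (k * integral {\<tau>..t} (\<lambda>r. (Hs_norm ip lam e 2 (f r))\<^sup>2) + (t - \<tau>) / k)"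
proof (cases "\<tau> = t")
  case True
  then show ?thesis using fi by (simp add: inviscid_solution_def)
next
  case False
  then have lt: "\<tau> < t" using \<tau> by simp
  let ?h = "\<lambda>r. (Hs_norm ip lam e 2 (f r))\<^sup>2" and ?D = "\<lambda>r. (norm (f r - fi r))\<^sup>2"
    and ?R = "norm (f \<tau>)"
  let ?b = "\<lambda>r. \<nu> * ?R * (k * ?h r + 1 / k)"
  define C where "C = \<nu> * ?R * (k * integral {\<tau>..t} ?h + (t - \<tau>) / k)"
  have int_h: "?h integrable_on {\<tau>..t}" by (rule viscous_H2(1)[OF \<tau>])
  have b_has: "(?b has_integral C) {\<tau>..t}"
  proof -
    have "((\<lambda>r. 1 / k) has_integral (t - \<tau>) / k) {\<tau>..t}"
      using has_integral_const_real[of "1 / k" \<tau> t] lt by simp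
    then show ?thesis
      unfolding C_def
      by (intro has_integral_mult_right has_integral_add integrable_integral[OF int_h])
  qed
  have step: "?D t - C \<le> ?D s" if s: "\<tau> < s" "s \<le> t" for s
  proof -
    let ?u = "\<lambda>r. - 2 * \<nu> * Re (ip (A (f r)) (f r - fi r))"
    \<comment> \<open>The solution is in H^2 at almost every time only. The value 0 at the
      exceptional times does not change the integral and lies below the nonnegative
      \<open>?b\<close>.\<close>
    let ?v = "\<lambda>r. if f r \<in> Hs ip lam e 2 then ?u r else 0"
    have "ddt_eq {\<tau><..} ?D ?u"
      using difference_energy[OF nu sol _ _ _ fi] viscous_in_H1[OF \<tau>(1)] \<tau> by simp
    then have u: "?u absolutely_integrable_on {s..t}" "?D t - ?D s = integral {s..t} ?u"
      using s unfolding ddt_eq_def by auto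
    have negl: "negligible {r \<in> {s..t}. f r \<notin> Hs ip lam e 2}"
      using viscous_H2(2)[of s t] \<tau> s by simp
    have "integral {s..t} ?u = integral {s..t} ?v"
      by (rule integral_spike[OF negl]) auto
    also have "\<dots> \<le> integral {s..t} ?b"
    proof (rule integral_le)
      show "?v integrable_on {s..t}"
        by (rule integrable_spike[OF set_lebesgue_integral_eq_integral(1)[OF u(1)] negl]) simp
      show "?b integrable_on {s..t}"
        using integrable_on_subinterval[OF has_integral_integrable[OF b_has], of s t] s by simp
      fix r assume r: "r \<in> {s..t}"
      have "norm (fi r) = ?R"
        using inviscid_norm[OF _ fi] \<tau> s r by simp
      then show "?v r \<le> ?b r"
        using mult_left_mono[OF Re_ip_A_diff_ge[OF _ k, of "f r" "fi r"], of \<nu>] nu k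
        by (auto simp: algebra_simps)
    qed
    also have "\<dots> \<le> integral {\<tau>..t} ?b"
      using s nu k has_integral_integrable[OF b_has]
        integrable_on_subinterval[OF has_integral_integrable[OF b_has], of s t]
      by (intro integral_subset_le) auto
    also have "\<dots> = C" using b_has by (rule integral_unique)
    finally show ?thesis using u(2) by simp
  qed
  \<comment> \<open>\<open>step\<close> holds for \<open>s\<close> strictly after
    \<open>\<tau>\<close>, with a constant \<open>C\<close> independent of \<open>s\<close>. By
    continuity \<open>s\<close> may tend to \<open>\<tau>\<close>, where the two solutions
    coincide.\<close>
  have "?D t - C \<le> ?D \<tau>"
  proof (rule continuous_ge_on_closure[where S = "{\<tau><..<t}" and f = ?D])
    have "continuous_on {\<tau>..} fi"
      using fi by (intro continuous_H1_imp_continuous) (simp add: inviscid_solution_def)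
    then show "continuous_on (closure {\<tau><..<t}) ?D"
      using lt \<tau> by (intro continuous_intros continuous_on_subset[OF viscous_continuous])
        (auto elim: continuous_on_subset)
    show "\<tau> \<in> closure {\<tau><..<t}" using lt by simp
    show "?D t - C \<le> ?D r" if "r \<in> {\<tau><..<t}" for r
      using step[of r] that by simp
  qed
  then show ?thesis
    using fi by (simp add: inviscid_solution_def C_def)
qed

end

section \<open>Energy decay over one window of length \<open>T\<close>\<close>

lemma viscous_window_decay:
  fixes p a :: real
  assumes nu: "0 < \<nu>" "\<nu> < 1" and sol: "viscous_solution ip DA A lam e B \<sigma> \<nu> f_in f"
    and p: "0 < p" and a: "0 < a"
    and mixing: "\<And>\<tau> f0 f t. 0 \<le> \<tau> \<Longrightarrow> f0 \<in> Hs ip lam e 1 \<Longrightarrow>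
      inviscid_solution ip lam e B \<sigma> \<tau> f0 f \<Longrightarrow> \<tau> < t \<Longrightarrow>
      Hs_norm ip lam e (-1) (f t) \<le> a / (t - \<tau>) powr p * Hs_norm ip lam e 1 f0"
    and m_def: "m = min (1 / (2 * (1 + c\<^sub>B))) (1 / (a * 4 powr p))"
    and T_def: "T = 1 / \<nu> powr (2 / (2 + p))"
    and \<tau>: "0 < \<tau>"
  shows "(norm (f (\<tau> + T)))\<^sup>2 \<le> (1 - m / 32) * (norm (f \<tau>))\<^sup>2"
proof (rule ccontr)
  assume contra: "\<not> ?thesis"
  define R where "R = norm (f \<tau>)"
  let ?g = "\<lambda>r. (Hs_norm ip lam e 1 (f r))\<^sup>2"
  let ?h = "\<lambda>r. (Hs_norm ip lam e 2 (f r))\<^sup>2"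
  note energy = viscous_energy_eq[OF nu sol]
  note decr = viscous_norm_decreasing_pos[OF nu sol]
  note g_int = set_lebesgue_integral_eq_integral(1)[OF viscous_H1_integrable[OF nu sol]]
  have m: "0 < m" "m * (1 + c\<^sub>B) \<le> 1 / 2" "m * (a * 4 powr p) \<le> 1"
  proof -
    show "0 < m" using cB_pos a by (simp add: m_def)
    have "m \<le> 1 / (2 * (1 + c\<^sub>B))" "m \<le> 1 / (a * 4 powr p)" by (simp_all add: m_def)
    then show "m * (1 + c\<^sub>B) \<le> 1 / 2" "m * (a * 4 powr p) \<le> 1"
      using cB_pos a by (simp_all add: field_simps)
  qed
  have m_cB: "0 < m * c\<^sub>B" using m cB_pos by simp
  have m_half: "m \<le> 1 / 2" using m m_cB by (simp add: algebra_simps)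
  have T1: "1 \<le> T"
    using nu p powr_mono2[of "2 / (2 + p)" \<nu> 1] by (simp add: T_def)
  then have T0: "0 < T" by simp
  \<comment> \<open>This is where the exponent comes from: for T = nu^(-q) the identity says 1 - q -
    q p / 2 = 0, that is, q = 2 / (2 + p).\<close>
  have nuT: "\<nu> * T * T powr (p / 2) = 1"
  proof -
    have "T = \<nu> powr (- (2 / (2 + p)))"
      by (simp add: T_def powr_minus_divide)
    then have "\<nu> * T * T powr (p / 2) = \<nu> powr 1 * \<nu> powr (- (2 / (2 + p))) * \<nu> powr (- (2 / (2 + p)) * (p / 2))"
      using nu by (simp add: powr_powr)
    also have "\<dots> = \<nu> powr (1 + - (2 / (2 + p)) + - (2 / (2 + p)) * (p / 2))"
      by (simp only: powr_add)
    also have "1 + - (2 / (2 + p)) + - (2 / (2 + p)) * (p / 2) = 0"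
      using p by (simp add: field_simps)
    finally show ?thesis using nu by simp
  qed
  have "R \<noteq> 0"
  proof
    assume "R = 0"
    then show False using contra decr[OF \<tau>, of "\<tau> + T"] T0 by (simp add: R_def)
  qed
  then have R: "0 < R" by (simp add: R_def)
  have big: "(1 - m / 32) * R\<^sup>2 < (norm (f (\<tau> + T)))\<^sup>2"
    using contra by (simp add: R_def)
  have norm_le_R: "norm (f s) \<le> R" if "\<tau> \<le> s" for s
    using viscous_norm_decreasing[OF nu sol, of \<tau> s] that \<tau> by (simp add: R_def)

  \<comment> \<open>Rounding down makes the pieces at least \<open>sqrt T\<close> long, which gives
    mixing enough time. As \<open>N\<close> is at least 1, \<open>sqrt T\<close> is at most
    \<open>2 * N\<close>, so \<open>L / N\<close> is at most 4, which keeps the H^2 contribution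
    small.\<close>
  define N where "N = nat \<lfloor>sqrt T\<rfloor>"
  have N: "1 \<le> N" "real N \<le> sqrt T" "sqrt T < real N + 1"
    using T1 by (auto simp: N_def le_nat_floor)
  then have N0: "0 < real N" by simp
  define L where "L = T / real N"
  have NL: "real N * L = T" using N0 by (simp add: L_def)
  have L0: "0 < L" using T0 N0 by (simp add: L_def)
  have L_ge: "sqrt T \<le> L"
  proof -
    have "sqrt T * real N \<le> sqrt T * sqrt T" using N T0 by (intro mult_left_mono) auto
    then show ?thesis using N0 T0 by (simp add: L_def field_simps)
  qed
  have L_le: "L \<le> 4 * real N"
  proof -
    have "sqrt T \<le> 2 * real N" using N by linarith
    then have "sqrt T * sqrt T \<le> (2 * real N) * (2 * real N)" using T0 by (intro mult_mono) auto
    then show ?thesis using N0 T0 by (simp add: L_def field_simps)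
  qed

  define \<phi> where "\<phi> i = (norm (f (\<tau> + real i * L)))\<^sup>2" for i
  \<comment> \<open>Pigeonhole: the losses on the pieces telescope to the loss on the window, so
    some piece loses less than an equal share of the bound.\<close>
  have "\<exists>i<N. \<phi> i - \<phi> (Suc i) < m / 32 * R\<^sup>2 / real N"
  proof (rule ccontr)
    assume "\<not> ?thesis"
    then have "(\<Sum>i<N. m / 32 * R\<^sup>2 / real N) \<le> (\<Sum>i<N. \<phi> i - \<phi> (Suc i))"
      by (intro sum_mono) (meson lessThan_iff not_less)
    also have "\<dots> = \<phi> 0 - \<phi> N" by (rule sum_lessThan_telescope')
    also have "\<dots> < m / 32 * R\<^sup>2"
      using big by (simp add: \<phi>_def NL R_def left_diff_distrib)
    finally show False using N0 by simp
  qed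
  then obtain i where i: "i < N" "\<phi> i - \<phi> (Suc i) < m / 32 * R\<^sup>2 / real N" by blast
  define u where "u = \<tau> + real i * L"
  have u: "\<tau> \<le> u" "0 < u" using L0 \<tau> by (auto simp: u_def add_pos_nonneg)
  have uL: "u + L \<le> \<tau> + T"
  proof -
    have "(real i + 1) * L \<le> real N * L" using i L0 by (intro mult_right_mono) auto
    then show ?thesis unfolding NL by (simp add: u_def distrib_right)
  qed
  \<comment> \<open>\<open>G\<close> is the bound on the energy loss of the chosen piece divided by
    \<open>2 * \<nu>\<close>, hence a bound on the integral of the squared H^1 norm.
    \<open>c\<close> is \<open>G\<close> averaged over a quarter of the piece.\<close>
  define G where "G = m * R\<^sup>2 / (64 * \<nu> * real N)"
  define c where "c = m * R\<^sup>2 / (16 * \<nu> * T)"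
  have G0: "0 < G" and c0: "0 < c" using m R nu N0 T0 by (simp_all add: G_def c_def)
  have G_c: "G = c * (L / 4)" using NL[symmetric] N0 L0 nu by (simp add: G_def c_def field_simps)
  have G: "integral {u..u + L} ?g < G"
  proof -
    have "2 * \<nu> * integral {u..u + L} ?g = \<phi> i - \<phi> (Suc i)"
      using energy[of u "u + L"] u L0 by (simp add: \<phi>_def u_def algebra_simps)
    moreover have "2 * \<nu> * G = m / 32 * R\<^sup>2 / real N"
      using nu by (simp add: G_def)
    ultimately have "2 * \<nu> * integral {u..u + L} ?g < 2 * \<nu> * G"
      using i by simp
    then show ?thesis using nu by simp
  qed
  have sub_int: "integral {s..t} ?g < G" if "u \<le> s" "t \<le> u + L" for s t
  proof -
    have "integral {s..t} ?g \<le> integral {u..u + L} ?g"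
      using that u by (intro integral_subset_le g_int) auto
    then show ?thesis using G by simp
  qed
  \<comment> \<open>The two times come from the first and the last quarter of the piece, which keeps
    them at least \<open>L / 2\<close> apart.\<close>
  obtain s1 where s1: "u \<le> s1" "s1 \<le> u + L / 4" "?g s1 < c"
    using exists_less_if_integral_less[OF g_int, of u "u + L / 4" c] sub_int[of u "u + L / 4"] u L0 G_c
    by auto
  obtain s2 where s2: "u + 3 * L / 4 \<le> s2" "s2 \<le> u + L" "?g s2 < c"
    using exists_less_if_integral_less[OF g_int, of "u + 3 * L / 4" "u + L" c]
      sub_int[of "u + 3 * L / 4" "u + L"] u L0 G_c
    by (auto simp: field_simps)
  have s12: "0 < s1" "s1 < s2" "L / 2 \<le> s2 - s1" "s2 - s1 \<le> L"
    using s1 s2 u L0 by auto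
  have H1: "f s1 \<in> Hs ip lam e 1" "f s2 \<in> Hs ip lam e 1"
    using viscous_in_H1[OF nu sol] s12 by auto
  obtain fi where fi: "inviscid_solution ip lam e B \<sigma> s1 (f s1) fi"
    using inviscid_exists[OF _ H1(1)] s12 by fastforce

  have D: "(norm (f s2 - fi s2))\<^sup>2 \<le> 3 / 8 * R\<^sup>2"
  proof -
    define X where "X = integral {s1..s2} ?h"
    \<comment> \<open>With this weight the term coming from \<open>L / k\<close> is exactly
      \<open>R\<^sup>2 / 4\<close>; the H^2 term will take another
      \<open>R\<^sup>2 / 8\<close>.\<close>
    define k where "k = 4 * \<nu> * L / R"
    have k: "0 < k" using nu L0 R by (simp add: k_def)
    have "2 * \<nu> * X \<le> ?g s1 + 2 * c\<^sub>B * integral {s1..s2} ?g"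
      using viscous_H2(3)[OF nu sol] s12 by (simp add: X_def)
    also have "\<dots> \<le> c + 2 * c\<^sub>B * G"
      using s1 s2 sub_int[of s1 s2] cB_pos by (intro add_mono mult_left_mono) auto
    finally have X: "2 * \<nu> * X \<le> c + 2 * c\<^sub>B * G" .
    have X0: "0 \<le> X"
      unfolding X_def using viscous_H2(1)[OF nu sol, of s1 s2] s12 by (intro integral_nonneg) auto
    have "(norm (f s2 - fi s2))\<^sup>2 \<le> \<nu> * norm (f s1) * (k * X + (s2 - s1) / k)"
      using viscous_inviscid_distance[OF nu sol _ _ k fi] s12 by (simp add: X_def)
    also have "\<dots> \<le> \<nu> * R * (k * X + L / k)"
      using norm_le_R[of s1] s1 u s12 nu k X0 R
      by (intro mult_mono add_mono divide_right_mono) auto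
    also have "\<dots> = 2 * \<nu> * L * (2 * \<nu> * X) + R\<^sup>2 / 4"
      using nu L0 R by (simp add: k_def field_simps power2_eq_square)
    also have "\<dots> \<le> 2 * \<nu> * L * (c + 2 * c\<^sub>B * G) + R\<^sup>2 / 4"
      using X nu L0 by (intro add_right_mono mult_left_mono) auto
    \<comment> \<open>The first entry of the minimum \<open>m\<close> is made for this: both
      contributions together are at most \<open>m * (1 + c\<^sub>B)\<close> times
      \<open>R\<^sup>2 / 4\<close>.\<close>
    also have "2 * \<nu> * L * (c + 2 * c\<^sub>B * G) \<le> R\<^sup>2 / 8"
    proof -
      have mR: "0 \<le> m * R\<^sup>2" using m by simp
      have "2 * \<nu> * L * c = m * R\<^sup>2 / 8 * (1 / real N)"
        using nu N0 L0 NL[symmetric] by (simp add: c_def field_simps)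
      also have "\<dots> \<le> m * R\<^sup>2 / 8 * 1"
        using N m by (intro mult_left_mono) auto
      finally have 1: "2 * \<nu> * L * c \<le> m * R\<^sup>2 / 4" using mR by simp
      have "2 * \<nu> * L * (2 * c\<^sub>B * G) = m * c\<^sub>B * R\<^sup>2 / 16 * (L / real N)"
        using nu N0 by (simp add: G_def field_simps)
      also have "\<dots> \<le> m * c\<^sub>B * R\<^sup>2 / 16 * 4"
      proof (rule mult_left_mono)
        show "L / real N \<le> 4" using L_le N0 by (simp add: field_simps)
        show "0 \<le> m * c\<^sub>B * R\<^sup>2 / 16" using m_cB by simp
      qed
      finally have "2 * \<nu> * L * (c + 2 * c\<^sub>B * G) \<le> m * (1 + c\<^sub>B) * (R\<^sup>2 / 4)"
        using 1 by (simp add: algebra_simps)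
      also have "\<dots> \<le> 1 / 2 * (R\<^sup>2 / 4)" using m by (intro mult_right_mono) auto
      finally show ?thesis by simp
    qed
    finally show ?thesis by simp
  qed

  have I: "inner (f s2) (fi s2) \<le> R\<^sup>2 / 16"
  proof -
    \<comment> \<open>Taking the mixing factor itself as the Young weight balances the two terms:
      each is at most \<open>k * c / 2\<close>.\<close>
    define k where "k = a / (s2 - s1) powr p"
    have k: "0 < k" using a s12 by (simp add: k_def)
    have "0 \<le> Hs_norm ip lam e (-1) (fi s2)"
      unfolding Hs_norm_def using H_minus1_UNIV[of "fi s2"]
      by (intro real_sqrt_ge_zero suminf_nonneg) (auto simp: Hs_def)
    then have "(Hs_norm ip lam e (-1) (fi s2))\<^sup>2 \<le> (k * Hs_norm ip lam e 1 (f s1))\<^sup>2"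
      using mixing[OF _ H1(1) fi, of s2] s12 by (intro power_mono) (simp_all add: k_def)
    also have "\<dots> \<le> k\<^sup>2 * c"
      using s1 k by (simp add: power_mult_distrib)
    finally have *: "(Hs_norm ip lam e (-1) (fi s2))\<^sup>2 \<le> k\<^sup>2 * c" .
    have "inner (f s2) (fi s2) \<le> k / 2 * ?g s2 + 1 / (2 * k) * (Hs_norm ip lam e (-1) (fi s2))\<^sup>2"
      by (rule inner_le_dual_norms[OF H1(2) k])
    also have "\<dots> \<le> k / 2 * c + 1 / (2 * k) * (k\<^sup>2 * c)"
      using s2 k * by (intro add_mono mult_left_mono) auto
    also have "\<dots> = k * c" using k by (simp add: field_simps power2_eq_square)
    \<comment> \<open>As \<open>s2 - s1\<close> is at least \<open>sqrt T / 2\<close>, the factor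
      \<open>k\<close> decays like \<open>T powr (- p / 2)\<close>. In the product with
      \<open>c\<close> the powers of \<open>T\<close> and \<open>\<nu>\<close> cancel by
      \<open>nuT\<close>, and the second entry of the minimum \<open>m\<close> absorbs the
      constant.\<close>
    also have "k * c \<le> R\<^sup>2 / 16"
    proof -
      have "sqrt T / 2 \<le> s2 - s1" using s12 L_ge by simp
      then have "(sqrt T / 2) powr p \<le> (s2 - s1) powr p"
        using p T0 by (intro powr_mono2) auto
      moreover have "(sqrt T / 2) powr p = T powr (p / 2) / 2 powr p"
        using T0 by (simp add: powr_divide powr_half_sqrt[symmetric] powr_powr)
      ultimately have "k \<le> a / (T powr (p / 2) / 2 powr p)"
        unfolding k_def using a T0 s12 by (intro divide_left_mono mult_pos_pos) auto
      then have "k * c \<le> a / (T powr (p / 2) / 2 powr p) * c"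
        using c0 by (intro mult_right_mono) auto
      also have "\<dots> = m * (a * 2 powr p) * (R\<^sup>2 / 16) / (\<nu> * T * T powr (p / 2))"
        using nu T0 by (simp add: c_def field_simps)
      also have "\<dots> = m * (a * 2 powr p) * (R\<^sup>2 / 16)" by (simp add: nuT)
      also have "\<dots> \<le> 1 * (R\<^sup>2 / 16)"
      proof (rule mult_right_mono)
        have "m * (a * 2 powr p) \<le> m * (a * 4 powr p)"
          using m a p by (intro mult_left_mono powr_mono2) auto
        then show "m * (a * 2 powr p) \<le> 1" using m(3) by (rule order_trans)
      qed simp
      finally show ?thesis by simp
    qed
    finally show ?thesis .
  qed

  \<comment> \<open>Splitting the energy at \<open>s2\<close> into its pairings with
    \<open>fi s2\<close> and with the error, half of it is absorbed on the left. What remains is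
    1/16 + 3/16 = 1/4 of \<open>R\<^sup>2\<close>, so at most half of the energy survives, against
    \<open>contra\<close>.\<close>
  have "inner (f s2) (f s2 - fi s2) \<le> norm (f s2) * norm (f s2 - fi s2)"
    by (rule norm_cauchy_schwarz)
  also have "\<dots> \<le> ((norm (f s2))\<^sup>2 + (norm (f s2 - fi s2))\<^sup>2) / 2"
    using sum_squares_bound[of "norm (f s2)" "norm (f s2 - fi s2)"] by simp
  finally have "inner (f s2) (f s2 - fi s2) \<le> ((norm (f s2))\<^sup>2 + (norm (f s2 - fi s2))\<^sup>2) / 2" .
  moreover have "(norm (f s2))\<^sup>2 = inner (f s2) (fi s2) + inner (f s2) (f s2 - fi s2)"
    by (simp add: inner_diff_right power2_norm_eq_inner)
  ultimately have "(norm (f s2))\<^sup>2 \<le> R\<^sup>2 / 2" using I D by argo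
  moreover have "(norm (f (\<tau> + T)))\<^sup>2 \<le> (norm (f s2))\<^sup>2"
    using decr[of s2 "\<tau> + T"] s12 s2 uL by simp
  moreover have "R\<^sup>2 / 2 \<le> (1 - m / 32) * R\<^sup>2"
    using m_half mult_right_mono[of "1 / 2" "1 - m / 32" "R\<^sup>2"] by simp
  ultimately show False using big by linarith
qed

section \<open>Iteration over windows ending at the final time\<close>

lemma viscous_enhanced_dissipation:
  fixes p a :: real
  assumes nu: "0 < \<nu>" "\<nu> < 1" and sol: "viscous_solution ip DA A lam e B \<sigma> \<nu> f_in f"
    and p: "0 < p" and a: "0 < a"
    and mixing: "\<And>\<tau> f0 f t. 0 \<le> \<tau> \<Longrightarrow> f0 \<in> Hs ip lam e 1 \<Longrightarrow>
      inviscid_solution ip lam e B \<sigma> \<tau> f0 f \<Longrightarrow> \<tau> < t \<Longrightarrow>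
      Hs_norm ip lam e (-1) (f t) \<le> a / (t - \<tau>) powr p * Hs_norm ip lam e 1 f0"
    and c_def: "c = 1 / 128 * min (1 / (2 * (1 + c\<^sub>B))) (1 / (a * 4 powr p))"
    and t: "1 / \<nu> powr (2 / (2 + p)) < t"
  shows "norm (f t) \<le> exp (- c * \<nu> powr (2 / (2 + p)) * t) * norm f_in"
proof -
  define T where "T = 1 / \<nu> powr (2 / (2 + p))"
  have T: "0 < T" using nu by (simp add: T_def)
  have c: "0 < c" using cB_pos a by (simp add: c_def)
  note cont = viscous_continuous[OF nu sol]
  \<comment> \<open>Here \<open>m = 128 * c\<close>, so the factor for the energy is
    \<open>1 - 4 * c\<close>, at most \<open>exp (- 4 * c)\<close>; the norm gets its square
    root.\<close>
  have pos: "norm (f (\<tau> + T)) \<le> exp (- 2 * c) * norm (f \<tau>)" if "0 < \<tau>" for \<tau>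
  proof (rule power2_le_imp_le)
    have "(norm (f (\<tau> + T)))\<^sup>2 \<le> (1 - 128 * c / 32) * (norm (f \<tau>))\<^sup>2"
      by (rule viscous_window_decay[OF nu sol p a _ _ T_def that]) (rule mixing, simp_all add: c_def)
    then have "(norm (f (\<tau> + T)))\<^sup>2 \<le> (1 - 4 * c) * (norm (f \<tau>))\<^sup>2" by simp
    also have "\<dots> \<le> exp (- 4 * c) * (norm (f \<tau>))\<^sup>2"
      using exp_ge_add_one_self[of "- 4 * c"] by (intro mult_right_mono) auto
    also have "\<dots> = (exp (- 2 * c) * norm (f \<tau>))\<^sup>2"
      by (simp add: power_mult_distrib flip: exp_double)
    finally show "(norm (f (\<tau> + T)))\<^sup>2 \<le> (exp (- 2 * c) * norm (f \<tau>))\<^sup>2" .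
  qed simp
  \<comment> \<open>The starting time 0, reached by continuity, occurs when \<open>t\<close> is an
    integer multiple of \<open>T\<close>.\<close>
  have step: "norm (f (\<tau> + T)) \<le> exp (- 2 * c) * norm (f \<tau>)" if "0 \<le> \<tau>" for \<tau>
  proof -
    have "0 \<le> exp (- 2 * c) * norm (f \<tau>) - norm (f (\<tau> + T))"
    proof (rule continuous_ge_on_closure[where S = "{0<..}"
          and f = "\<lambda>\<tau>. exp (- 2 * c) * norm (f \<tau>) - norm (f (\<tau> + T))"])
      show "continuous_on (closure {0<..}) (\<lambda>\<tau>. exp (- 2 * c) * norm (f \<tau>) - norm (f (\<tau> + T)))"
        using T by (intro continuous_intros continuous_on_compose2[OF cont]) auto
    qed (use pos that in auto)
    then show ?thesis by simp
  qed
  have iter: "norm (f (\<tau> + real n * T)) \<le> exp (- 2 * c * real n) * norm (f \<tau>)" if "0 \<le> \<tau>" for \<tau> n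
  proof (induction n)
    case (Suc n)
    have "norm (f (\<tau> + real (Suc n) * T)) \<le> exp (- 2 * c) * norm (f (\<tau> + real n * T))"
      using step[of "\<tau> + real n * T"] that T by (simp add: algebra_simps)
    also have "\<dots> \<le> exp (- 2 * c) * (exp (- 2 * c * real n) * norm (f \<tau>))"
      using Suc by (intro mult_left_mono) auto
    also have "\<dots> = exp (- 2 * c * real (Suc n)) * norm (f \<tau>)"
      by (simp add: algebra_simps flip: exp_add)
    finally show ?case .
  qed simp
  \<comment> \<open>Windows are laid backwards from \<open>t\<close>, leaving an initial stretch
    shorter than \<open>T\<close> on which the norm merely does not grow. Since \<open>t\<close>
    exceeds \<open>T\<close>, there is at least one window and
    \<open>t / T < n + 1 \<le> 2 * n\<close>: halving the rate \<open>2 * c\<close> pays for the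
    initial stretch, and no prefactor is left.\<close>
  define n where "n = nat \<lfloor>t / T\<rfloor>"
  have n: "1 \<le> n" "real n \<le> t / T" "t / T < real n + 1"
    using t T by (auto simp: n_def le_nat_floor T_def[symmetric])
  define \<tau> where "\<tau> = t - real n * T"
  have \<tau>: "0 \<le> \<tau>" using n T by (simp add: \<tau>_def field_simps)
  have "norm (f t) \<le> exp (- 2 * c * real n) * norm (f \<tau>)"
    using iter[OF \<tau>, of n] by (simp add: \<tau>_def)
  also have "\<dots> \<le> exp (- c * (t / T)) * norm f_in"
  proof (rule mult_mono)
    have "c * (t / T) \<le> c * (2 * real n)" using n c by (intro mult_left_mono) auto
    then show "exp (- 2 * c * real n) \<le> exp (- c * (t / T))" by (simp add: algebra_simps)
    show "norm (f \<tau>) \<le> norm f_in"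
      using viscous_norm_decreasing[OF nu sol _ \<tau>] viscous_initial[OF nu sol] by simp
  qed auto
  also have "- c * (t / T) = - c * \<nu> powr (2 / (2 + p)) * t" by (simp add: T_def)
  finally show ?thesis .
qed

end

theorem theorem2p1:
  fixes K :: "complex set"
    and smul :: "complex \<Rightarrow> 'h::{real_inner, complete_space} \<Rightarrow> 'h"
    and ip :: "'h \<Rightarrow> 'h \<Rightarrow> complex"
    and DA :: "'h set" and A :: "'h \<Rightarrow> 'h"
    and lam :: "nat \<Rightarrow> real" and e :: "nat \<Rightarrow> 'h"
    and DB :: "real \<Rightarrow> 'h set" and B :: "real \<Rightarrow> 'h \<Rightarrow> 'h"
    and \<sigma> c\<^sub>B p a :: real
  assumes setting: "well_posed_family K smul ip DA A lam e DB B \<sigma> c\<^sub>B"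
    and p_pos: "0 < p" and a_pos: "0 < a"
    and mixing: "\<And>\<tau> f0 f t. 0 \<le> \<tau> \<Longrightarrow> f0 \<in> Hs ip lam e 1 \<Longrightarrow>
      inviscid_solution ip lam e B \<sigma> \<tau> f0 f \<Longrightarrow> \<tau> < t \<Longrightarrow>
      Hs_norm ip lam e (-1) (f t) \<le> a / (t - \<tau>) powr p * Hs_norm ip lam e 1 f0"
  shows "let q = 2 / (2 + p);
             c\<^sub>0 = 1 / 128 * min (1 / (2 * (1 + c\<^sub>B))) (1 / (a * 4 powr p))
         in \<forall>\<nu> f_in f. 0 < \<nu> \<longrightarrow> \<nu> < 1 \<longrightarrow>
              viscous_solution ip DA A lam e B \<sigma> \<nu> f_in f \<longrightarrow>
              (\<forall>t > 1 / \<nu> powr q. norm (f t) \<le> exp (- c\<^sub>0 * \<nu> powr q * t) * norm f_in)"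
  unfolding Let_def
proof (intro allI impI)
  fix \<nu> f_in f t
  assume "0 < \<nu>" "\<nu> < 1" "viscous_solution ip DA A lam e B \<sigma> \<nu> f_in f" "1 / \<nu> powr (2 / (2 + p)) < t"
  then show "norm (f t) \<le> exp (- (1 / 128 * min (1 / (2 * (1 + c\<^sub>B))) (1 / (a * 4 powr p))) *
      \<nu> powr (2 / (2 + p)) * t) * norm f_in"
    using well_posed_family.viscous_enhanced_dissipation[OF setting _ _ _ p_pos a_pos _ refl] mixing
    by blast
qed

end
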